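(* Let $\Gamma=(N,(C_i)_{i\in N},(U_i)_{i\in N})$ be a finite game. There exists a Nash equilibrium $\sigma$ of $\Gamma$ such that, for every player $i\in N$ and every pure strategy $c_i\in C_i$ with marginal probability zero in all correlated equilibria of $\Gamma$, $c_i$ is not a best response to $\sigma_{-i}$.
   Context: A finite game in strategic form is $\Gamma=(N,(C_i)_{i\in N},(U_i)_{i\in N})$, where $N$ is a finite nonempty set of players, $C_i$ is the finite nonempty set of pure strategies of player $i$, $C=\prod_{j\in N}C_j$, $C_{-i}=\prod_{j\ne i}C_j$, and $U_i:C\to\mathbb{R}$ is the utility function of player $i$, extended multilinearly to mixed strategies. $(c_{-i},d_i)$ denotes the profile obtained from $c$ by replacing the $i$-component by $d_i$. Nash equilibria may be in mixed strategies. A correlated equilibrium of $\Gamma$ is a probability distribution $\mu\in\Delta(C)$ such that $\sum_{c_{-i}\in C_{-i}}\mu(c)[U_i(c_{-i},d_i)-U_i(c)]\le 0$ for all $i\in N$, $c_i\in C_i$, $d_i\in C_i$ (where $c=(c_{-i},c_i)$). The marginal probability of $c_i$ in $\mu$ is $\sum_{c_{-i}\in C_{-i}}\mu(c_{-i},c_i)$. *)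

theory Defs
  imports "HOL-Probability.Probability_Mass_Function"
begin

text \<open>
  Pure strategy profiles are the extensional functions in \<open>\<Pi>\<^sub>E i\<in>N. C i\<close>, and the utility
  functions are only ever evaluated there. All players draw their strategies from one type
  \<open>'s\<close>, which loses no generality, since the sets \<open>C i\<close> may be embedded in a disjoint union.
\<close>

definition finite_game ::
    "'i set \<Rightarrow> ('i \<Rightarrow> 's set) \<Rightarrow> ('i \<Rightarrow> ('i \<Rightarrow> 's) \<Rightarrow> real) \<Rightarrow> bool" where
  "finite_game N C U \<longleftrightarrow>
     finite N \<and> N \<noteq> {} \<and> (\<forall>i\<in>N. finite (C i) \<and> C i \<noteq> {})"

definition profiles :: "'i set \<Rightarrow> ('i \<Rightarrow> 's set) \<Rightarrow> ('i \<Rightarrow> 's) set" where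
  "profiles N C = (\<Pi>\<^sub>E i\<in>N. C i)"

definition mixed_strategies :: "('i \<Rightarrow> 's set) \<Rightarrow> 'i \<Rightarrow> 's pmf set" where
  "mixed_strategies C i = {p. set_pmf p \<subseteq> C i}"

definition mixed_utility ::
    "'i set \<Rightarrow> ('i \<Rightarrow> 's set) \<Rightarrow> ('i \<Rightarrow> ('i \<Rightarrow> 's) \<Rightarrow> real) \<Rightarrow> 'i \<Rightarrow> ('i \<Rightarrow> 's pmf) \<Rightarrow> real" where
  "mixed_utility N C U i \<sigma> =
     (\<Sum>c\<in>profiles N C. (\<Prod>j\<in>N. pmf (\<sigma> j) (c j)) * U i c)"

text \<open>
  The value \<open>\<sigma> i\<close> is overwritten on both sides, so that only \<open>\<sigma>\<^sub>-\<^sub>i\<close> matters. A pure strategy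
  \<open>c\<close> is the mixed strategy \<open>return_pmf c\<close>.
\<close>

definition best_response ::
    "'i set \<Rightarrow> ('i \<Rightarrow> 's set) \<Rightarrow> ('i \<Rightarrow> ('i \<Rightarrow> 's) \<Rightarrow> real) \<Rightarrow> 'i \<Rightarrow> 's pmf \<Rightarrow> ('i \<Rightarrow> 's pmf) \<Rightarrow> bool"
  where
  "best_response N C U i \<tau> \<sigma> \<longleftrightarrow>
     \<tau> \<in> mixed_strategies C i \<and>
     (\<forall>\<rho>\<in>mixed_strategies C i.
        mixed_utility N C U i (\<sigma>(i := \<rho>)) \<le> mixed_utility N C U i (\<sigma>(i := \<tau>)))"

definition nash_equilibrium ::
    "'i set \<Rightarrow> ('i \<Rightarrow> 's set) \<Rightarrow> ('i \<Rightarrow> ('i \<Rightarrow> 's) \<Rightarrow> real) \<Rightarrow> ('i \<Rightarrow> 's pmf) \<Rightarrow> bool" where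
  "nash_equilibrium N C U \<sigma> \<longleftrightarrow> (\<forall>i\<in>N. best_response N C U i (\<sigma> i) \<sigma>)"

definition correlated_equilibrium ::
    "'i set \<Rightarrow> ('i \<Rightarrow> 's set) \<Rightarrow> ('i \<Rightarrow> ('i \<Rightarrow> 's) \<Rightarrow> real) \<Rightarrow> ('i \<Rightarrow> 's) pmf \<Rightarrow> bool" where
  "correlated_equilibrium N C U \<mu> \<longleftrightarrow>
     set_pmf \<mu> \<subseteq> profiles N C \<and>
     (\<forall>i\<in>N. \<forall>a\<in>C i. \<forall>d\<in>C i.
        (\<Sum>c\<in>profiles (N - {i}) C. pmf \<mu> (c(i := a)) * (U i (c(i := d)) - U i (c(i := a)))) \<le> 0)"

definition marginal_prob ::
    "'i set \<Rightarrow> ('i \<Rightarrow> 's set) \<Rightarrow> ('i \<Rightarrow> 's) pmf \<Rightarrow> 'i \<Rightarrow> 's \<Rightarrow> real" where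
  "marginal_prob N C \<mu> i a = (\<Sum>c\<in>profiles (N - {i}) C. pmf \<mu> (c(i := a)))"

end

theory Submission
  imports Defs "HOL-Analysis.Brouwer_Fixpoint"
begin

text \<open>
The proof is Myerson's dual reduction. The correlated equilibria are the solutions of linear
incentive constraints with one multiplier \<open>\<alpha> i a d\<close> for each player \<open>i\<close> who is told to play \<open>a\<close> and
considers \<open>d\<close> instead. Farkas' lemma, applied to each profile that has probability zero in all
correlated equilibria, yields multipliers under which the total gain \<open>dual_gain U \<alpha> c\<close> is
nonnegative at all profiles \<open>c\<close> and positive at all those null profiles
(\<open>strict_dual_kernel_exists\<close>). After scaling, and with the missing mass on the diagonal, each \<open>\<alpha> i\<close> is a
stochastic matrix, a random way for player \<open>i\<close> to disobey.

Call a mixed profile invariant if each \<open>\<sigma> j\<close> is stationary for the Markov chain \<open>\<alpha> j\<close>. Against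
invariant opponents only the disobedience of player \<open>i\<close> has an effect, so nonnegativity of the total
gain says that replacing \<open>a\<close> by a draw from \<open>\<alpha> i a\<close> never hurts, and positivity that it
strictly helps when all profiles containing \<open>a\<close> are null (\<open>expected_dual_gain_pure\<close>). In an
invariant Nash equilibrium such an \<open>a\<close> is thus strictly worse than an average of pure strategies,
none of which exceeds the equilibrium payoff, and so it is no best response.

An invariant equilibrium exists (\<open>invariant_equilibrium_exists\<close>) because restricting the players to
invariant strategies costs them nothing: running the chain from \<open>a\<close> and averaging over time leads in
the limit to an invariant strategy that is at least as good as \<open>a\<close> against invariant opponents
(\<open>invariant_kernel_exists\<close>). Treating these limits as the pure strategies of an auxiliary finite
game reduces the claim to Nash's theorem (\<open>nash_exists\<close>), which follows from Brouwer's theorem on a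
cube whose dimension is the total number of pure strategies.
\<close>

section \<open>Farkas' lemma\<close>

definition linear_functional :: "(('v \<Rightarrow> real) \<Rightarrow> real) \<Rightarrow> bool" where
  "linear_functional f \<longleftrightarrow> (\<forall>x y t. f (\<lambda>v. x v + t * y v) = f x + t * f y)"

lemma linear_functionalD:
  "linear_functional f \<Longrightarrow> f (\<lambda>v. x v + t * y v) = f x + t * f y"
  by (simp add: linear_functional_def)

lemma linear_functional_zero: "linear_functional f \<Longrightarrow> f (\<lambda>v. 0) = 0"
  using linear_functionalD[of f "\<lambda>v. 0" 1 "\<lambda>v. 0"] by simp

lemma linear_functional_scale: "linear_functional f \<Longrightarrow> f (\<lambda>v. t * y v) = t * f y"
  using linear_functionalD[of f "\<lambda>v. 0" t y] linear_functional_zero[of f] by simp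

text \<open>
Bartl's induction on the number of functionals. If \<open>f m\<close> is needed, some \<open>z\<close> violates the
implication for the other functionals (\<open>f k z \<le> 0 < g z\<close>), and then \<open>f m z > 0\<close>; scaled to \<open>f m z = 1\<close>, it splits the
space into the kernel of \<open>f m\<close> and the line through \<open>z\<close>. On the kernel one functional has
disappeared, and the coefficient of \<open>f m\<close>, read off at \<open>z\<close>, comes out nonnegative exactly
because \<open>z\<close> is such a violation.
\<close>

lemma farkas_functionals:
  fixes f :: "'k \<Rightarrow> ('v \<Rightarrow> real) \<Rightarrow> real"
  assumes "finite K" "\<forall>k\<in>K. linear_functional (f k)" "linear_functional g"
    and "\<forall>x. (\<forall>k\<in>K. f k x \<le> 0) \<longrightarrow> g x \<le> 0"
  shows "\<exists>u. (\<forall>k\<in>K. 0 \<le> u k) \<and> (\<forall>x. g x = (\<Sum>k\<in>K. u k * f k x))"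
  using assms
proof (induction K arbitrary: f g rule: finite_induct)
  case empty
  have "g x = 0" for x
    using empty.prems(3)[rule_format, of x] empty.prems(3)[rule_format, of "\<lambda>v. - 1 * x v"]
      linear_functional_scale[OF empty.prems(2), of "-1" x] by simp
  then show ?case by simp
next
  case (insert m K)
  note lin = insert.prems(1) and ling = insert.prems(2) and imp = insert.prems(3)
  show ?case
  proof (cases "\<forall>x. (\<forall>k\<in>K. f k x \<le> 0) \<longrightarrow> g x \<le> 0")
    case True
    from insert.IH[OF _ ling True] lin
    obtain u where u: "\<forall>k\<in>K. 0 \<le> u k" "\<forall>x. g x = (\<Sum>k\<in>K. u k * f k x)" by auto
    have "(\<Sum>k\<in>K. (u(m := 0)) k * f k x) = (\<Sum>k\<in>K. u k * f k x)" for x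
      using insert.hyps(2) by (intro sum.cong) auto
    then show ?thesis using u insert.hyps
      by (intro exI[of _ "u(m := 0)"]) auto
  next
    case False
    then obtain y where y: "\<forall>k\<in>K. f k y \<le> 0" "g y > 0" by (auto simp: not_le)
    have fmy: "f m y > 0"
      using imp[rule_format, of y] y by (auto simp: not_le[symmetric])
    define z where "z = (\<lambda>v. (1 / f m y) * y v)"
    have fz: "f k z = f k y / f m y" if "k \<in> insert m K" for k
      unfolding z_def using linear_functional_scale[of "f k" "1 / f m y" y] that lin by auto
    have gz: "g z > 0"
      unfolding z_def using linear_functional_scale[OF ling, of "1 / f m y" y] y fmy by simp
    have fmz: "f m z = 1" using fz[of m] fmy by simp
    have fkz: "f k z \<le> 0" if "k \<in> K" for k
      using fz[of k] that y fmy by (simp add: divide_nonpos_pos)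
    \<comment> \<open>The projection onto the kernel of \<open>f m\<close> along \<open>z\<close> removes one functional.\<close>
    define pr where "pr = (\<lambda>x v. x v + (- f m x) * z v)"
    have proj: "h (pr x) = h x - f m x * h z" if "linear_functional h" for h x
      unfolding pr_def using linear_functionalD[OF that, of x "- f m x" z] by simp
    have linpr: "linear_functional (\<lambda>x. h (pr x))" if "linear_functional h" for h
      unfolding proj[OF that] linear_functional_def
      using linear_functionalD[OF that] linear_functionalD[of "f m"] lin
      by (auto simp: algebra_simps)
    have "\<exists>u. (\<forall>k\<in>K. 0 \<le> u k) \<and> (\<forall>x. g (pr x) = (\<Sum>k\<in>K. u k * f k (pr x)))"
    proof (rule insert.IH[of "\<lambda>k x. f k (pr x)" "\<lambda>x. g (pr x)"])
      show "\<forall>k\<in>K. linear_functional (\<lambda>x. f k (pr x))" using lin linpr by blast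
      show "linear_functional (\<lambda>x. g (pr x))" using ling linpr by blast
      show "\<forall>x. (\<forall>k\<in>K. f k (pr x) \<le> 0) \<longrightarrow> g (pr x) \<le> 0"
        using imp lin proj[of "f m"] fmz by auto
    qed
    then obtain u where u: "\<forall>k\<in>K. 0 \<le> u k" "\<And>x. g (pr x) = (\<Sum>k\<in>K. u k * f k (pr x))"
      by blast
    \<comment> \<open>The coefficient of \<open>f m\<close> is forced by evaluating both sides at \<open>z\<close>.\<close>
    define t where "t = g z - (\<Sum>k\<in>K. u k * f k z)"
    have "(\<Sum>k\<in>K. u k * f k z) \<le> 0"
      using u fkz by (intro sum_nonpos) (auto simp: mult_nonneg_nonpos)
    then have t: "t \<ge> 0" using gz unfolding t_def by simp
    have eq: "g x = t * f m x + (\<Sum>k\<in>K. u k * f k x)" for x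
    proof -
      have "g x = f m x * g z + g (pr x)" using proj[OF ling] by simp
      also have "g (pr x) = (\<Sum>k\<in>K. u k * f k x - f m x * (u k * f k z))"
        unfolding u(2)
      proof (intro sum.cong refl)
        fix k assume "k \<in> K"
        then have p: "f k (pr x) = f k x - f m x * f k z" using proj lin by blast
        show "u k * f k (pr x) = u k * f k x - f m x * (u k * f k z)"
          unfolding p by (simp add: algebra_simps)
      qed
      finally show ?thesis
        by (simp add: t_def sum_subtractf sum_distrib_left algebra_simps)
    qed
    have "(\<Sum>k\<in>K. (u(m := t)) k * f k x) = (\<Sum>k\<in>K. u k * f k x)" for x
      using insert.hyps(2) by (intro sum.cong) auto
    then show ?thesis using u(1) t eq insert.hyps
      by (intro exI[of _ "u(m := t)"]) auto
  qed
qed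

text \<open>
The form used for correlated equilibria, whose probabilities are sign-constrained: the
constraints \<open>x v \<ge> 0\<close> join the functionals of the homogeneous lemma as a second summand of
the index type, and their multipliers become the slack of the final inequality.
\<close>

lemma farkas_nonneg:
  fixes M :: "'k \<Rightarrow> 'v \<Rightarrow> real" and b :: "'v \<Rightarrow> real"
  assumes fin: "finite K" "finite V"
    and imp: "\<And>x. \<forall>v\<in>V. 0 \<le> x v \<Longrightarrow> \<forall>k\<in>K. (\<Sum>v\<in>V. M k v * x v) \<le> 0 \<Longrightarrow> (\<Sum>v\<in>V. b v * x v) \<le> 0"
  shows "\<exists>u. (\<forall>k\<in>K. 0 \<le> u k) \<and> (\<forall>v\<in>V. b v \<le> (\<Sum>k\<in>K. u k * M k v))"
proof -
  define f where "f = case_sum (\<lambda>k x. \<Sum>v\<in>V. M k v * x v) (\<lambda>v x. - x v :: real)"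
  have lin: "linear_functional (\<lambda>x. \<Sum>v\<in>V. a v * x v)" for a :: "'v \<Rightarrow> real"
    by (simp add: linear_functional_def sum_distrib_left sum.distrib algebra_simps)
  have "\<exists>u. (\<forall>k\<in>K <+> V. 0 \<le> u k) \<and>
      (\<forall>x. (\<Sum>v\<in>V. b v * x v) = (\<Sum>k\<in>K <+> V. u k * f k x))"
  proof (rule farkas_functionals)
    show "finite (K <+> V)" using fin by simp
    show "\<forall>k\<in>K <+> V. linear_functional (f k)"
      using lin by (auto simp: f_def) (simp add: linear_functional_def)
    show "linear_functional (\<lambda>x. \<Sum>v\<in>V. b v * x v)" by (rule lin)
    show "\<forall>x. (\<forall>k\<in>K <+> V. f k x \<le> 0) \<longrightarrow> (\<Sum>v\<in>V. b v * x v) \<le> 0"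
    proof (intro allI impI)
      fix x assume a: "\<forall>k\<in>K <+> V. f k x \<le> 0"
      have "0 \<le> x v" if "v \<in> V" for v
        using a[rule_format, of "Inr v"] that by (auto simp: f_def)
      moreover have "(\<Sum>v\<in>V. M k v * x v) \<le> 0" if "k \<in> K" for k
        using a[rule_format, of "Inl k"] that by (auto simp: f_def)
      ultimately show "(\<Sum>v\<in>V. b v * x v) \<le> 0" using imp by blast
    qed
  qed
  then obtain u where u: "\<forall>k\<in>K <+> V. 0 \<le> u k"
    "\<And>x. (\<Sum>v\<in>V. b v * x v) = (\<Sum>k\<in>K <+> V. u k * f k x)" by blast
  have "b w \<le> (\<Sum>k\<in>K. u (Inl k) * M k w)" if w: "w \<in> V" for w
  proof -
    have e: "(\<Sum>v\<in>V. a v * (if v = w then 1 else 0)) = a w" for a :: "'v \<Rightarrow> real"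
    proof -
      have "(\<Sum>v\<in>V. a v * (if v = w then 1 else 0)) = (\<Sum>v\<in>V. if v = w then a v else 0)"
        by (intro sum.cong) auto
      then show ?thesis using fin w by (simp add: sum.delta)
    qed
    have e': "(\<Sum>v\<in>V. - (u (Inr v) * (if v = w then 1 else 0))) = - u (Inr w)"
      using e[of "\<lambda>v. u (Inr v)"] by (simp add: sum_negf)
    have "b w = (\<Sum>k\<in>K. u (Inl k) * M k w) - u (Inr w)"
      using u(2)[of "\<lambda>v. if v = w then 1 else 0"] fin
      unfolding e by (simp add: sum.Plus f_def e e' o_def)
    moreover have "0 \<le> u (Inr w)" using u(1) w by auto
    ultimately show ?thesis by simp
  qed
  then show ?thesis using u(1) by (intro exI[of _ "\<lambda>k. u (Inl k)"]) auto
qed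

section \<open>Brouwer's theorem on a finite cube\<close>

lemma pointwise_convergent_subsequence:
  fixes f :: "nat \<Rightarrow> 'x \<Rightarrow> real"
  assumes "finite S" and "\<And>n x. x \<in> S \<Longrightarrow> 0 \<le> f n x \<and> f n x \<le> 1"
  shows "\<exists>r l. strict_mono (r :: nat \<Rightarrow> nat) \<and> (\<forall>x\<in>S. (\<lambda>n. f (r n) x) \<longlonglongrightarrow> l x)"
  using assms
proof (induction S rule: finite_induct)
  case empty
  then show ?case by (auto intro: exI[of _ id] strict_mono_id)
next
  case (insert y S)
  then obtain r l where r: "strict_mono r" "\<forall>x\<in>S. (\<lambda>n. f (r n) x) \<longlonglongrightarrow> l x" by auto
  have "seq_compact {0..1::real}" by (simp add: compact_imp_seq_compact)
  moreover have "\<forall>n. f (r n) y \<in> {0..1}" using insert.prems by auto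
  ultimately obtain q m where q: "strict_mono q" "((\<lambda>n. f (r n) y) \<circ> q) \<longlonglongrightarrow> m"
    by (rule seq_compactE) blast
  have "(\<lambda>n. f ((r \<circ> q) n) x) \<longlonglongrightarrow> (l(y := m)) x" if "x \<in> insert y S" for x
  proof (cases "x = y")
    case True then show ?thesis using q(2) by (simp add: o_def)
  next
    case False
    then show ?thesis
      using LIMSEQ_subseq_LIMSEQ[OF r(2)[rule_format, of x] q(1)] that by (simp add: o_def)
  qed
  then show ?case using strict_mono_o[OF r(1) q(1)] by blast
qed

text \<open>
The dimension is the cardinality of a finite index set rather than a type, so the theorem is
derived from Kuhn's combinatorial lemma. Cut the cube into cells of side \<open>1 / p\<close> and label a grid
point in direction \<open>k\<close> by \<open>0\<close> if \<open>F\<close> does not decrease its coordinate \<open>k\<close>, and by \<open>1\<close> if \<open>F\<close> does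
not increase it. Kuhn's lemma supplies a cell in which both labels occur in every direction. As
\<open>p\<close> grows, the cells of a subsequence shrink to one point, where continuity leaves neither
increase nor decrease. Continuity is sequential and coordinatewise, so that no topology on the
function space is involved.
\<close>

lemma brouwer_finite_cube:
  fixes F :: "('k \<Rightarrow> real) \<Rightarrow> 'k \<Rightarrow> real"
  assumes fin: "finite I"
    and maps: "\<And>x k. \<forall>k\<in>I. 0 \<le> x k \<and> x k \<le> 1 \<Longrightarrow> k \<in> I \<Longrightarrow> 0 \<le> F x k \<and> F x k \<le> 1"
    and cont: "\<And>X x k. (\<And>n k. k \<in> I \<Longrightarrow> 0 \<le> X n k \<and> X n k \<le> 1) \<Longrightarrow>
        (\<And>k. k \<in> I \<Longrightarrow> (\<lambda>n. X n k) \<longlonglongrightarrow> x k) \<Longrightarrow> k \<in> I \<Longrightarrow> (\<lambda>n. F (X n) k) \<longlonglongrightarrow> F x k"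
  shows "\<exists>x. \<forall>k\<in>I. F x k = x k \<and> 0 \<le> x k \<and> x k \<le> 1"
proof -
  define d where "d = card I"
  obtain h where h: "bij_betw h {..<d} I"
    using ex_bij_betw_nat_finite[OF fin] unfolding d_def atLeast0LessThan by blast
  define idx where "idx = inv_into {..<d} h"
  have idx: "idx k < d" "h (idx k) = k" if "k \<in> I" for k
    using that h unfolding idx_def bij_betw_def
    by (auto simp: f_inv_into_f dest: inv_into_into[of k h "{..<d}"])
  define grid where "grid p q = (\<lambda>k. real (q (idx k)) / real p)" for p :: nat and q :: "nat \<Rightarrow> nat"
  \<comment> \<open>On the boundary the label is prescribed; \<open>F\<close> maps the cube to itself, so it still tells the truth.\<close>
  define label where "label p q i = (if q i = 0 then 0 else if q i = p then 1
      else if grid p q (h i) \<le> F (grid p q) (h i) then 0 else 1 :: nat)" for p q i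
  define near where "near q r \<longleftrightarrow> (\<forall>j<d. q j \<le> r j \<and> r j \<le> q j + (1::nat))" for q r
  have grid_range: "0 \<le> grid p r k \<and> grid p r k \<le> 1"
    if "\<forall>i<d. r i \<le> p" "0 < p" "k \<in> I" for p r k
    using that idx[of k] by (auto simp: grid_def)
  have label0: "grid p r k \<le> F (grid p r) k"
    if "label p r (idx k) = 0" "\<forall>i<d. r i \<le> p" "0 < p" "k \<in> I" for p r k
    using that idx[of k] maps[of "grid p r" k] grid_range[OF that(2,3)]
    by (auto simp: label_def grid_def split: if_splits)
  have label1: "F (grid p r) k \<le> grid p r k"
    if "label p r (idx k) \<noteq> 0" "\<forall>i<d. r i \<le> p" "0 < p" "k \<in> I" for p r k
    using that idx[of k] maps[of "grid p r" k] grid_range[OF that(2,3)]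
    by (auto simp: label_def grid_def split: if_splits)
  have "\<exists>q. (\<forall>i<d. q i < p) \<and>
      (\<forall>k\<in>I. \<exists>r s. near q r \<and> near q s \<and> label p r (idx k) = 0 \<and> label p s (idx k) \<noteq> 0)"
    if p: "0 < p" for p
  proof -
    obtain q where q: "\<forall>i<d. q i < p" and
      rs: "\<forall>i<d. \<exists>r s. near q r \<and> near q s \<and> label p r i \<noteq> label p s i"
      unfolding near_def
    proof (rule kuhn_lemma[OF p, of d "label p"])
      show "\<forall>x. (\<forall>i<d. x i \<le> p) \<longrightarrow> (\<forall>i<d. label p x i = 0 \<or> label p x i = 1)"
        by (simp add: label_def)
      show "\<forall>x. (\<forall>i<d. x i \<le> p) \<longrightarrow> (\<forall>i<d. x i = 0 \<longrightarrow> label p x i = 0)"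
        by (simp add: label_def)
      show "\<forall>x. (\<forall>i<d. x i \<le> p) \<longrightarrow> (\<forall>i<d. x i = p \<longrightarrow> label p x i = 1)"
        using p by (simp add: label_def)
    qed blast
    show ?thesis
    proof (rule exI[of _ q], intro conjI q ballI)
      fix k assume "k \<in> I"
      then obtain r s where rs': "near q r" "near q s" "label p r (idx k) \<noteq> label p s (idx k)"
        using rs idx by blast
      have "label p t (idx k) = 0 \<or> label p t (idx k) = 1" for t by (simp add: label_def)
      then show "\<exists>r s. near q r \<and> near q s \<and> label p r (idx k) = 0 \<and> label p s (idx k) \<noteq> 0"
        using rs' by metis
    qed
  qed
  then have "\<forall>n. \<exists>q. (\<forall>i<d. q i < Suc n) \<and>
      (\<forall>k\<in>I. \<exists>r s. near q r \<and> near q s \<and> label (Suc n) r (idx k) = 0 \<and> label (Suc n) s (idx k) \<noteq> 0)"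
    by auto
  then obtain q where q: "\<And>n. \<forall>i<d. q n i < Suc n" and
    rs: "\<And>n. \<forall>k\<in>I. \<exists>r s. near (q n) r \<and> near (q n) s \<and> label (Suc n) r (idx k) = 0
        \<and> label (Suc n) s (idx k) \<noteq> 0"
    by metis
  have "\<exists>r s. near (q n) r \<and> near (q n) s \<and> (k \<in> I \<longrightarrow> label (Suc n) r (idx k) = 0
        \<and> label (Suc n) s (idx k) \<noteq> 0)" for n k
    using rs[of n] by (cases "k \<in> I") (auto simp: near_def)
  then obtain r s where near_r: "\<And>n k. near (q n) (r n k)" and near_s: "\<And>n k. near (q n) (s n k)"
    and lab_r: "\<And>n k. k \<in> I \<Longrightarrow> label (Suc n) (r n k) (idx k) = 0"
    and lab_s: "\<And>n k. k \<in> I \<Longrightarrow> label (Suc n) (s n k) (idx k) \<noteq> 0"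
    by metis
  \<comment> \<open>The corners \<open>r n k\<close> and \<open>s n k\<close> of the \<open>n\<close>-th cell are labelled \<open>0\<close> and \<open>1\<close> in direction \<open>k\<close>.\<close>
  define X where "X n = grid (Suc n) (q n)" for n
  have near_le: "\<forall>i<d. t i \<le> Suc n" if "near (q n) t" for n t
    using that q[of n] unfolding near_def by (metis Suc_eq_plus1 Suc_leI le_trans Suc_le_mono)
  have X_range: "0 \<le> X n k \<and> X n k \<le> 1" if "k \<in> I" for n k
    unfolding X_def using q[of n] that by (intro grid_range) (auto intro: less_imp_le)
  obtain w x where w: "strict_mono (w :: nat \<Rightarrow> nat)"
    and Xlim: "\<forall>k\<in>I. (\<lambda>n. X (w n) k) \<longlonglongrightarrow> x k"
    using pointwise_convergent_subsequence[OF fin, of X] X_range by blast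
  have lim: "(\<lambda>n. grid (Suc (w n)) (t (w n)) k) \<longlonglongrightarrow> x k"
    if t: "\<And>n. near (q n) (t n)" and k: "k \<in> I" for t k
  proof (rule tendsto_sandwich[OF _ _ Xlim[rule_format, OF k]])
    have b: "real (q n (idx k)) \<le> real (t n (idx k))" "real (t n (idx k)) \<le> real (q n (idx k)) + 1" for n
      using t[of n] idx[OF k] unfolding near_def by (force, metis of_nat_1 of_nat_add of_nat_le_iff)
    show "\<forall>\<^sub>F n in sequentially. X (w n) k \<le> grid (Suc (w n)) (t (w n)) k"
      using b unfolding X_def grid_def by (intro always_eventually allI divide_right_mono) auto
    show "\<forall>\<^sub>F n in sequentially. grid (Suc (w n)) (t (w n)) k \<le> X (w n) k + inverse (real (Suc (w n)))"
    proof (intro always_eventually allI)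
      fix n
      have "grid (Suc (w n)) (t (w n)) k \<le> (real (q (w n) (idx k)) + 1) / real (Suc (w n))"
        using b unfolding grid_def by (intro divide_right_mono) auto
      then show "grid (Suc (w n)) (t (w n)) k \<le> X (w n) k + inverse (real (Suc (w n)))"
        unfolding X_def grid_def add_divide_distrib by (simp add: inverse_eq_divide)
    qed
    show "(\<lambda>n. X (w n) k + inverse (real (Suc (w n)))) \<longlonglongrightarrow> x k"
      using tendsto_add[OF Xlim[rule_format, OF k]
          LIMSEQ_subseq_LIMSEQ[OF LIMSEQ_inverse_real_of_nat w, unfolded o_def]] by simp
  qed
  have "F x k = x k" if k: "k \<in> I" for k
  proof (rule antisym)
    have Flim: "(\<lambda>n. F (grid (Suc (w n)) (t (w n))) k) \<longlonglongrightarrow> F x k"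
      if "\<And>n. near (q n) (t n)" for t
      using that near_le by (intro cont[OF _ lim k] grid_range) auto
    show "x k \<le> F x k"
      using near_r lab_r k near_le
      by (intro LIMSEQ_le[OF lim[of "\<lambda>n. r n k"] Flim[of "\<lambda>n. r n k"]] exI allI impI label0) auto
    show "F x k \<le> x k"
      using near_s lab_s k near_le
      by (intro LIMSEQ_le[OF Flim[of "\<lambda>n. s n k"] lim[of "\<lambda>n. s n k"]] exI allI impI label1) auto
  qed
  moreover have "0 \<le> x k \<and> x k \<le> 1" if "k \<in> I" for k
    using Xlim that X_range by (meson LIMSEQ_le_const LIMSEQ_le_const2)
  ultimately show ?thesis by blast
qed

section \<open>Expected utilities\<close>

text \<open>
Mixed strategies are real functions whose values outside the strategy sets do not matter. This
keeps the multilinear algebra free of probability mass functions, which return only in the final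
theorem.
\<close>

definition expected ::
    "'i set \<Rightarrow> ('i \<Rightarrow> 's set) \<Rightarrow> (('i \<Rightarrow> 's) \<Rightarrow> real) \<Rightarrow> ('i \<Rightarrow> 's \<Rightarrow> real) \<Rightarrow> real" where
  "expected N C u \<sigma> = (\<Sum>c\<in>Pi\<^sub>E N C. (\<Prod>j\<in>N. \<sigma> j (c j)) * u c)"

definition distribution :: "'s set \<Rightarrow> ('s \<Rightarrow> real) \<Rightarrow> bool" where
  "distribution A p \<longleftrightarrow> (\<forall>a\<in>A. 0 \<le> p a) \<and> sum p A = 1"

definition point_mass :: "'s \<Rightarrow> 's \<Rightarrow> real" where
  "point_mass a = (\<lambda>x. if x = a then 1 else 0)"

text \<open>
The product of the row vector \<open>p\<close> and the matrix \<open>k\<close>: the law after drawing \<open>a\<close> from \<open>p\<close> and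
then replacing it by a draw from \<open>k a\<close>.
\<close>

definition push :: "'s set \<Rightarrow> ('s \<Rightarrow> real) \<Rightarrow> ('s \<Rightarrow> 's \<Rightarrow> real) \<Rightarrow> 's \<Rightarrow> real" where
  "push A p k = (\<lambda>x. \<Sum>a\<in>A. p a * k a x)"

lemma sum_point_mass: "finite A \<Longrightarrow> a \<in> A \<Longrightarrow> (\<Sum>x\<in>A. point_mass a x * f x) = f a"
proof -
  assume "finite A" "a \<in> A"
  have "(\<Sum>x\<in>A. point_mass a x * f x) = (\<Sum>x\<in>A. if x = a then f x else 0)"
    by (intro sum.cong) (auto simp: point_mass_def)
  then show ?thesis using \<open>finite A\<close> \<open>a \<in> A\<close> by (simp add: sum.delta)
qed

lemma distribution_point_mass: "finite A \<Longrightarrow> a \<in> A \<Longrightarrow> distribution A (point_mass a)"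
  using sum_point_mass[of A a "\<lambda>_. 1"] by (auto simp: distribution_def) (auto simp: point_mass_def)

lemma distribution_positive:
  assumes "distribution A p"
  shows "\<exists>a\<in>A. 0 < p a"
  using assms sum_nonpos[of A p] by (force simp: distribution_def not_less)

lemma distribution_push:
  assumes "distribution A p" "\<And>a. a \<in> A \<Longrightarrow> distribution A (k a)"
  shows "distribution A (push A p k)"
proof -
  have "(\<Sum>x\<in>A. \<Sum>a\<in>A. p a * k a x) = (\<Sum>a\<in>A. p a * (\<Sum>x\<in>A. k a x))"
    by (subst sum.swap) (simp add: sum_distrib_left)
  also have "\<dots> = 1" using assms by (simp add: distribution_def)
  finally show ?thesis using assms by (auto simp: distribution_def push_def intro!: sum_nonneg)
qed

lemma sum_push: "(\<Sum>x\<in>A. push A p k x * g x) = (\<Sum>a\<in>A. p a * (\<Sum>x\<in>A. k a x * g x))"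
  unfolding push_def sum_distrib_left sum_distrib_right
  by (subst sum.swap) (simp add: mult.assoc)

lemma sum_PiE_split:
  fixes g :: "('i \<Rightarrow> 's) \<Rightarrow> real"
  assumes "i \<in> N"
  shows "(\<Sum>c\<in>Pi\<^sub>E N C. g c) = (\<Sum>b\<in>Pi\<^sub>E (N - {i}) C. \<Sum>a\<in>C i. g (b(i := a)))"
proof -
  have "Pi\<^sub>E N C = (\<lambda>(a, b). b(i := a)) ` (C i \<times> Pi\<^sub>E (N - {i}) C)"
    using PiE_insert_eq[of i "N - {i}" C] assms by (simp add: insert_absorb)
  moreover have "inj_on (\<lambda>(a, b). b(i := a)) (C i \<times> Pi\<^sub>E (N - {i}) C)"
    using inj_combinator[of i "N - {i}" C] by (simp add: case_prod_beta')
  ultimately have "(\<Sum>c\<in>Pi\<^sub>E N C. g c)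
      = (\<Sum>(a, b)\<in>C i \<times> Pi\<^sub>E (N - {i}) C. g (b(i := a)))"
    by (simp add: sum.reindex case_prod_beta' o_def)
  also have "\<dots> = (\<Sum>a\<in>C i. \<Sum>b\<in>Pi\<^sub>E (N - {i}) C. g (b(i := a)))"
    by (rule sum.cartesian_product[symmetric])
  finally show ?thesis by (subst sum.swap)
qed

locale finite_strategies =
  fixes N :: "'i set" and C :: "'i \<Rightarrow> 's set"
  assumes finite_players: "finite N"
    and finite_C: "i \<in> N \<Longrightarrow> finite (C i)"
    and C_nonempty: "i \<in> N \<Longrightarrow> C i \<noteq> {}"
begin

abbreviation "EU \<equiv> expected N C"

lemma finite_profiles: "finite (Pi\<^sub>E N C)"
  using finite_players finite_C by (rule finite_PiE)

lemma expected_cong: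
  assumes "\<And>j x. j \<in> N \<Longrightarrow> x \<in> C j \<Longrightarrow> \<sigma> j x = \<sigma>' j x"
  shows "EU u \<sigma> = EU u \<sigma>'"
  unfolding expected_def using assms
  by (intro sum.cong refl arg_cong2[where f = "(*)"] prod.cong) (auto dest: PiE_mem)

lemma expected_diff: "EU (\<lambda>c. u c - v c) \<sigma> = EU u \<sigma> - EU v \<sigma>"
  by (simp add: expected_def sum_subtractf algebra_simps)

lemma expected_sum: "EU (\<lambda>c. \<Sum>k\<in>K. u k c) \<sigma> = (\<Sum>k\<in>K. EU (u k) \<sigma>)"
  unfolding expected_def sum_distrib_left by (rule sum.swap)

lemma expected_split:
  assumes "i \<in> N"
  shows "EU u \<sigma> = (\<Sum>b\<in>Pi\<^sub>E (N - {i}) C. (\<Prod>j\<in>N - {i}. \<sigma> j (b j)) *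
           (\<Sum>a\<in>C i. \<sigma> i a * u (b(i := a))))"
proof -
  have "(\<Prod>j\<in>N. \<sigma> j ((b(i := a)) j)) = \<sigma> i a * (\<Prod>j\<in>N - {i}. \<sigma> j (b j))" for b a
    by (subst prod.remove[OF finite_players assms]) (auto intro!: prod.cong)
  then show ?thesis
    unfolding expected_def
    by (subst sum_PiE_split[OF assms]) (simp add: sum_distrib_left mult_ac)
qed

text \<open>
Linearity in the strategy of one player, which is why no mixed deviation beats all pure ones.
\<close>

lemma expected_pure:
  assumes "i \<in> N"
  shows "EU u (\<sigma>(i := p)) = (\<Sum>a\<in>C i. p a * EU u (\<sigma>(i := point_mass a)))"
proof -
  have "(\<Prod>j\<in>N - {i}. (\<sigma>(i := q)) j (b j)) = (\<Prod>j\<in>N - {i}. \<sigma> j (b j))" for q b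
    by (intro prod.cong) auto
  then have s: "EU u (\<sigma>(i := q)) = (\<Sum>b\<in>Pi\<^sub>E (N - {i}) C. (\<Prod>j\<in>N - {i}. \<sigma> j (b j)) *
           (\<Sum>a\<in>C i. q a * u (b(i := a))))" for q
    by (simp add: expected_split[OF assms])
  have "EU u (\<sigma>(i := point_mass a))
      = (\<Sum>b\<in>Pi\<^sub>E (N - {i}) C. (\<Prod>j\<in>N - {i}. \<sigma> j (b j)) * u (b(i := a)))" if "a \<in> C i" for a
    unfolding s using sum_point_mass[OF finite_C[OF assms] that] by simp
  then have "(\<Sum>a\<in>C i. p a * EU u (\<sigma>(i := point_mass a)))
     = (\<Sum>a\<in>C i. \<Sum>b\<in>Pi\<^sub>E (N - {i}) C. (\<Prod>j\<in>N - {i}. \<sigma> j (b j)) * (p a * u (b(i := a))))"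
    by (intro sum.cong refl) (simp add: sum_distrib_left mult_ac)
  also have "\<dots> = EU u (\<sigma>(i := p))"
    unfolding s by (subst sum.swap) (simp add: sum_distrib_left)
  finally show ?thesis by simp
qed

text \<open>
A player who privately randomises after drawing from \<open>\<sigma> j\<close> plays, in effect, a different
independent mixed strategy.
\<close>

lemma expected_deviation:
  assumes "j \<in> N"
  shows "EU (\<lambda>c. \<Sum>d\<in>C j. k (c j) d * u (c(j := d))) \<sigma> = EU u (\<sigma>(j := push (C j) (\<sigma> j) k))"
proof -
  have "(\<Prod>l\<in>N - {j}. (\<sigma>(j := push (C j) (\<sigma> j) k)) l (b l)) = (\<Prod>l\<in>N - {j}. \<sigma> l (b l))" for b
    by (intro prod.cong) auto
  then show ?thesis
    by (simp add: expected_split[OF assms] sum_push)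
qed

text \<open>
If every pure strategy \<open>a\<close> of every player is taken to mean the mixed strategy \<open>E j a\<close>, a
mixed profile of this new game is a mixed profile of the old one; expanding the product of sums
shows that utilities agree.
\<close>

lemma expected_substitute:
  "EU (\<lambda>c. EU u (\<lambda>j. E j (c j))) \<sigma> = EU u (\<lambda>j. push (C j) (\<sigma> j) (E j))"
proof -
  have "(\<Prod>j\<in>N. push (C j) (\<sigma> j) (E j) (d j))
      = (\<Sum>c\<in>Pi\<^sub>E N C. (\<Prod>j\<in>N. \<sigma> j (c j)) * (\<Prod>j\<in>N. E j (c j) (d j)))" for d
    unfolding push_def by (subst prod_sum_PiE) (auto simp: finite_players finite_C prod.distrib)
  then show ?thesis
    unfolding expected_def
    by (simp add: sum_distrib_left sum_distrib_right mult.assoc) (rule sum.swap)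
qed

lemma profile_positive:
  assumes "\<And>j. j \<in> N \<Longrightarrow> distribution (C j) (\<sigma> j)"
  obtains c where "c \<in> Pi\<^sub>E N C" "\<And>j. j \<in> N \<Longrightarrow> 0 < \<sigma> j (c j)"
proof -
  have "\<exists>a\<in>C j. 0 < \<sigma> j a" if "j \<in> N" for j
    using assms[OF that] by (rule distribution_positive)
  then obtain f where "\<And>j. j \<in> N \<Longrightarrow> f j \<in> C j \<and> 0 < \<sigma> j (f j)" by metis
  then show thesis using that[of "restrict f N"] by auto
qed

lemma expected_nonneg:
  assumes "\<And>j. j \<in> N \<Longrightarrow> distribution (C j) (\<sigma> j)" "\<And>c. c \<in> Pi\<^sub>E N C \<Longrightarrow> 0 \<le> u c"
  shows "0 \<le> EU u \<sigma>"
  unfolding expected_def using assms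
  by (intro sum_nonneg mult_nonneg_nonneg prod_nonneg) (auto simp: distribution_def dest: PiE_mem)

lemma expected_pos:
  assumes dist: "\<And>j. j \<in> N \<Longrightarrow> distribution (C j) (\<sigma> j)" and nonneg: "\<And>c. c \<in> Pi\<^sub>E N C \<Longrightarrow> 0 \<le> u c"
    and pos: "\<And>c. c \<in> Pi\<^sub>E N C \<Longrightarrow> (\<And>j. j \<in> N \<Longrightarrow> 0 < \<sigma> j (c j)) \<Longrightarrow> 0 < u c"
  shows "0 < EU u \<sigma>"
proof -
  obtain c where c: "c \<in> Pi\<^sub>E N C" "\<And>j. j \<in> N \<Longrightarrow> 0 < \<sigma> j (c j)"
    using profile_positive[OF dist] by blast
  show ?thesis
    unfolding expected_def
  proof (rule sum_pos2[OF finite_profiles c(1)])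
    show "0 < (\<Prod>j\<in>N. \<sigma> j (c j)) * u c" using c pos by (simp add: prod_pos)
    show "0 \<le> (\<Prod>j\<in>N. \<sigma> j (c j)) * u c" if "c \<in> Pi\<^sub>E N C" for c
      using that dist nonneg
      by (intro mult_nonneg_nonneg prod_nonneg) (auto simp: distribution_def dest: PiE_mem)
  qed
qed

lemma tendsto_expected:
  assumes "\<And>j a. j \<in> N \<Longrightarrow> a \<in> C j \<Longrightarrow> (\<lambda>n. S n j a) \<longlonglongrightarrow> \<sigma> j a"
  shows "(\<lambda>n. EU u (S n)) \<longlonglongrightarrow> EU u \<sigma>"
  unfolding expected_def using assms
  by (intro tendsto_sum tendsto_mult tendsto_prod tendsto_const) (auto dest: PiE_mem)

section \<open>Nash's theorem\<close>

text \<open>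
A continuous map from the cube to the product of simplices that fixes the latter: missing mass
is spread evenly over the strategies, and excess mass is removed by scaling.
\<close>

definition project_simplex :: "('i \<times> 's \<Rightarrow> real) \<Rightarrow> 'i \<Rightarrow> 's \<Rightarrow> real" where
  "project_simplex x i a =
     (x (i, a) + max 0 (1 - (\<Sum>b\<in>C i. x (i, b))) / card (C i)) / max 1 (\<Sum>b\<in>C i. x (i, b))"

lemma distribution_project_simplex:
  assumes "i \<in> N" "\<And>a. a \<in> C i \<Longrightarrow> 0 \<le> x (i, a)"
  shows "distribution (C i) (project_simplex x i)"
proof -
  let ?s = "\<Sum>b\<in>C i. x (i, b)"
  have "card (C i) > 0" using finite_C C_nonempty assms by (simp add: card_gt_0_iff)
  then have "(\<Sum>a\<in>C i. project_simplex x i a) = (?s + max 0 (1 - ?s)) / max 1 ?s"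
    by (simp add: project_simplex_def sum_divide_distrib[symmetric] sum.distrib)
  also have "\<dots> = 1" by (simp add: max_def)
  finally show ?thesis
    using assms by (auto simp: distribution_def project_simplex_def intro!: divide_nonneg_nonneg add_nonneg_nonneg)
qed

definition gain :: "(('i \<Rightarrow> 's) \<Rightarrow> real) \<Rightarrow> ('i \<Rightarrow> 's \<Rightarrow> real) \<Rightarrow> 'i \<Rightarrow> 's \<Rightarrow> real" where
  "gain u \<sigma> i a = max 0 (EU u (\<sigma>(i := point_mass a)) - EU u \<sigma>)"

text \<open>
Nash's improvement map: shift weight towards the strategies with a positive gain and rescale.
At a fixed point, some strategy in the support does not beat the average, so it has no gain;
since its weight is nevertheless unchanged by the rescaling, the total gain vanishes. The
retraction \<open>project_simplex\<close> extends the map to the cube, where a fixed point exists.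
\<close>

theorem nash_exists:
  fixes V :: "'i \<Rightarrow> ('i \<Rightarrow> 's) \<Rightarrow> real"
  shows "\<exists>\<sigma>. (\<forall>i\<in>N. distribution (C i) (\<sigma> i)) \<and>
    (\<forall>i\<in>N. \<forall>a\<in>C i. EU (V i) (\<sigma>(i := point_mass a)) \<le> EU (V i) \<sigma>)"
proof -
  define G where "G \<sigma> i = (\<Sum>b\<in>C i. gain (V i) \<sigma> i b)" for \<sigma> i
  define better where "better \<sigma> i a = (\<sigma> i a + gain (V i) \<sigma> i a) / (1 + G \<sigma> i)" for \<sigma> i a
  define F where "F x k = (case k of (i, a) \<Rightarrow> better (project_simplex x) i a)" for x k
  have gain_nonneg: "0 \<le> gain u \<sigma> i a" for u \<sigma> i a by (simp add: gain_def)
  then have G_nonneg: "0 \<le> G \<sigma> i" for \<sigma> i by (simp add: G_def sum_nonneg)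
  have dist_better: "distribution (C i) (better \<sigma> i)" if "distribution (C i) (\<sigma> i)" for \<sigma> i
  proof -
    have "(\<Sum>a\<in>C i. better \<sigma> i a) = (1 + G \<sigma> i) / (1 + G \<sigma> i)"
      using that by (simp add: better_def sum_divide_distrib[symmetric] sum.distrib distribution_def G_def)
    then show ?thesis
      using that gain_nonneg G_nonneg[of \<sigma> i] by (auto simp: distribution_def better_def intro!: divide_nonneg_nonneg add_nonneg_nonneg)
  qed
  have finI: "finite (Sigma N C)" using finite_players finite_C by auto
  have dist_F: "distribution (C i) (\<lambda>a. F x (i, a))" if "i \<in> N" "\<forall>k\<in>Sigma N C. 0 \<le> x k \<and> x k \<le> 1" for i x
    unfolding F_def using that dist_better distribution_project_simplex by auto
  have "\<exists>x. \<forall>k\<in>Sigma N C. F x k = x k \<and> 0 \<le> x k \<and> x k \<le> 1"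
  proof (rule brouwer_finite_cube[OF finI])
    fix x k assume x: "\<forall>k\<in>Sigma N C. 0 \<le> x k \<and> x k \<le> (1 :: real)" and k: "k \<in> Sigma N C"
    obtain i a where ia: "k = (i, a)" "i \<in> N" "a \<in> C i" using k by auto
    have "F x (i, a) \<le> sum (\<lambda>a. F x (i, a)) (C i)"
      using dist_F[OF ia(2) x] ia finite_C by (intro member_le_sum) (auto simp: distribution_def)
    then show "0 \<le> F x k \<and> F x k \<le> 1" using dist_F[OF ia(2) x] ia by (auto simp: distribution_def)
  next
    fix X :: "nat \<Rightarrow> 'i \<times> 's \<Rightarrow> real" and x k
    assume lim: "\<And>k. k \<in> Sigma N C \<Longrightarrow> (\<lambda>n. X n k) \<longlonglongrightarrow> x k" and k: "k \<in> Sigma N C"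
    have ps: "(\<lambda>n. project_simplex (X n) j a) \<longlonglongrightarrow> project_simplex x j a" if "j \<in> N" "a \<in> C j" for j a
      unfolding project_simplex_def using that C_nonempty finite_C
      by (intro tendsto_intros tendsto_max lim) auto
    have gn: "(\<lambda>n. gain (V j) (project_simplex (X n)) j a) \<longlonglongrightarrow> gain (V j) (project_simplex x) j a"
      if "j \<in> N" for j a
      unfolding gain_def using that
      by (intro tendsto_max tendsto_diff tendsto_expected tendsto_const) (auto intro: ps)
    have "1 + G (project_simplex x) i \<noteq> 0" for i using G_nonneg[of "project_simplex x" i] by linarith
    then show "(\<lambda>n. F (X n) k) \<longlonglongrightarrow> F x k"
      using k ps gn unfolding F_def better_def G_def by (auto intro!: tendsto_intros)
  qed
  then obtain x where x: "\<forall>k\<in>Sigma N C. F x k = x k \<and> 0 \<le> x k \<and> x k \<le> 1" by blast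
  define \<sigma> where "\<sigma> = project_simplex x"
  have dist: "distribution (C i) (\<sigma> i)" if "i \<in> N" for i
    unfolding \<sigma>_def using that x by (intro distribution_project_simplex) auto
  have fixed: "better \<sigma> i a = \<sigma> i a" if "i \<in> N" "a \<in> C i" for i a
  proof -
    have "(\<Sum>b\<in>C i. x (i, b)) = (\<Sum>b\<in>C i. F x (i, b))" using x that by (intro sum.cong) auto
    also have "\<dots> = 1" using dist_F[OF that(1)] x by (simp add: distribution_def)
    finally have "\<sigma> i a = x (i, a)" by (simp add: \<sigma>_def project_simplex_def)
    then show ?thesis using x that by (force simp: F_def \<sigma>_def)
  qed
  have "EU (V i) (\<sigma>(i := point_mass a)) \<le> EU (V i) \<sigma>" if i: "i \<in> N" and a: "a \<in> C i" for i a
  proof -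
    define e where "e b = EU (V i) (\<sigma>(i := point_mass b)) - EU (V i) \<sigma>" for b
    have "(\<Sum>b\<in>C i. \<sigma> i b * e b)
        = (\<Sum>b\<in>C i. \<sigma> i b * EU (V i) (\<sigma>(i := point_mass b))) - (\<Sum>b\<in>C i. \<sigma> i b) * EU (V i) \<sigma>"
      unfolding e_def by (simp add: right_diff_distrib sum_subtractf sum_distrib_right)
    also have "\<dots> = 0"
      using expected_pure[OF i, of "V i" \<sigma> "\<sigma> i"] dist[OF i] by (simp add: distribution_def)
    finally have avg: "(\<Sum>b\<in>C i. \<sigma> i b * e b) = 0" .
    \<comment> \<open>The excesses \<open>e\<close> average to zero, so they cannot all be positive on the support.\<close>
    have "\<exists>b\<in>C i. 0 < \<sigma> i b \<and> e b \<le> 0"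
    proof (rule ccontr)
      assume "\<not> ?thesis"
      then have e: "0 < e b" if "b \<in> C i" "0 < \<sigma> i b" for b using that by (auto simp: not_le)
      obtain b where b: "b \<in> C i" "0 < \<sigma> i b"
        using distribution_positive[OF dist[OF i]] by blast
      have "0 < (\<Sum>b\<in>C i. \<sigma> i b * e b)"
      proof (rule sum_pos2[OF finite_C[OF i] b(1)])
        show "0 < \<sigma> i b * e b" using b e by simp
        fix b assume "b \<in> C i"
        then have "0 \<le> \<sigma> i b" using dist[OF i] by (auto simp: distribution_def)
        then show "0 \<le> \<sigma> i b * e b" using e[OF \<open>b \<in> C i\<close>] by (cases "\<sigma> i b = 0") auto
      qed
      then show False using avg by simp
    qed
    then obtain b where b: "b \<in> C i" "0 < \<sigma> i b" "gain (V i) \<sigma> i b = 0"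
      by (auto simp: gain_def e_def)
    have "\<sigma> i b = \<sigma> i b / (1 + G \<sigma> i)" using fixed[OF i b(1)] b(3) by (simp add: better_def)
    then have "G \<sigma> i = 0" using b(2) G_nonneg[of \<sigma> i] by (simp add: field_simps)
    then have "gain (V i) \<sigma> i a = 0"
      using sum_nonneg_eq_0_iff[OF finite_C[OF i], of "gain (V i) \<sigma> i"] gain_nonneg a by (auto simp: G_def)
    then show ?thesis by (simp add: gain_def)
  qed
  then show ?thesis using dist by blast
qed

end

section \<open>Invariant distributions of a stochastic kernel\<close>

fun iterate :: "'s set \<Rightarrow> ('s \<Rightarrow> 's \<Rightarrow> real) \<Rightarrow> 's \<Rightarrow> nat \<Rightarrow> 's \<Rightarrow> real" where
  "iterate A k a 0 = point_mass a"
| "iterate A k a (Suc t) = push A (iterate A k a t) k"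

text \<open>
A limit point of the averages of the laws of the Markov chain \<open>k\<close> started at \<open>a\<close>. Averaging makes it
invariant: one more step changes the average of \<open>n + 1\<close> laws by at most \<open>1 / (n + 1)\<close>. A function
\<open>g\<close> that does not decrease on average in one step does not decrease along the chain, hence not in
the limit. One \<open>p\<close> serves all such \<open>g\<close>; this matters because \<open>g\<close> will depend on an equilibrium
that is constructed from \<open>p\<close>.
\<close>

lemma invariant_kernel_exists:
  assumes fin: "finite A" and stoch: "\<And>a. a \<in> A \<Longrightarrow> distribution A (k a)" and a: "a \<in> A"
  shows "\<exists>p. distribution A p \<and> (\<forall>x\<in>A. push A p k x = p x) \<and>
    (\<forall>g. (\<forall>b\<in>A. g b \<le> (\<Sum>x\<in>A. k b x * g x)) \<longrightarrow> g a \<le> (\<Sum>x\<in>A. p x * g x))"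
proof -
  let ?P = "iterate A k a"
  define Q where "Q n x = (\<Sum>t<Suc n. ?P t x) / real (Suc n)" for n x
  have avg: "(\<Sum>x\<in>A. Q n x * g x) = (\<Sum>t<Suc n. \<Sum>x\<in>A. ?P t x * g x) / real (Suc n)" for n g
    unfolding Q_def sum.swap[of _ A] by (simp only: sum_divide_distrib sum_distrib_right times_divide_eq_left) 
  have distP: "distribution A (?P t)" for t
    by (induction t) (auto intro: distribution_point_mass[OF fin a] distribution_push stoch)
  have distQ: "distribution A (Q n)" for n
    using avg[of n "\<lambda>_. 1"] distP
    by (auto simp: distribution_def) (auto simp: Q_def intro!: divide_nonneg_nonneg sum_nonneg add_nonneg_nonneg)
  have Q_range: "0 \<le> Q n x \<and> Q n x \<le> 1" if "x \<in> A" for n x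
    using member_le_sum[OF that, of "Q n"] distQ[of n] that fin by (auto simp: distribution_def)
  obtain r p where r: "strict_mono (r :: nat \<Rightarrow> nat)" and lim: "\<forall>x\<in>A. (\<lambda>n. Q (r n) x) \<longlonglongrightarrow> p x"
    using pointwise_convergent_subsequence[OF fin, of Q] Q_range by blast
  have lim_avg: "(\<lambda>n. \<Sum>x\<in>A. Q (r n) x * g x) \<longlonglongrightarrow> (\<Sum>x\<in>A. p x * g x)" for g
    using lim by (intro tendsto_sum tendsto_mult tendsto_const) auto
  have "distribution A p"
  proof -
    have "(\<lambda>n. 1 :: real) \<longlonglongrightarrow> sum p A"
      using lim_avg[of "\<lambda>_. 1"] distQ by (simp add: distribution_def)
    then have "sum p A = 1" using LIMSEQ_unique tendsto_const by blast
    moreover have "0 \<le> p x" if "x \<in> A" for x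
      using lim that Q_range by (meson LIMSEQ_le_const)
    ultimately show ?thesis by (simp add: distribution_def)
  qed
  moreover have "push A p k x = p x" if x: "x \<in> A" for x
  proof -
    have shift: "push A (Q n) k x - Q n x = (?P (Suc n) x - ?P 0 x) / real (Suc n)" for n
    proof -
      have "push A (Q n) k x = (\<Sum>t<Suc n. ?P (Suc t) x) / real (Suc n)"
        unfolding push_def using avg[of n "\<lambda>b. k b x"] by (simp add: push_def)
      then show ?thesis
        unfolding Q_def using sum_lessThan_telescope[of "\<lambda>t. ?P t x" "Suc n"]
        by (simp only: diff_divide_distrib[symmetric] sum_subtractf)
    qed
    have "(\<lambda>n. push A (Q (r n)) k x - Q (r n) x) \<longlonglongrightarrow> push A p k x - p x"
      unfolding push_def using lim_avg[of "\<lambda>b. k b x"] lim x by (intro tendsto_diff) auto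
    moreover have "(\<lambda>n. push A (Q (r n)) k x - Q (r n) x) \<longlonglongrightarrow> 0"
    proof (rule LIMSEQ_subseq_LIMSEQ[OF _ r, unfolded o_def])
      have "\<bar>push A (Q n) k x - Q n x\<bar> \<le> inverse (real (Suc n))" for n
      proof -
        have "0 \<le> ?P t x \<and> ?P t x \<le> 1" for t
          using member_le_sum[OF x, of "?P t"] distP[of t] x fin by (auto simp: distribution_def)
        from this[of 0] this[of "Suc n"] have "\<bar>?P (Suc n) x - ?P 0 x\<bar> \<le> 1"
          by linarith
        from divide_right_mono[OF this, of "real (Suc n)"] show ?thesis
          unfolding shift by (simp add: inverse_eq_divide abs_divide del: iterate.simps of_nat_Suc)
      qed
      then show "(\<lambda>n. push A (Q n) k x - Q n x) \<longlonglongrightarrow> 0"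
        by (intro tendsto_rabs_zero_cancel[OF tendsto_sandwich[OF _ _ tendsto_const LIMSEQ_inverse_real_of_nat]]) auto
    qed
    ultimately show ?thesis using LIMSEQ_unique by fastforce
  qed
  moreover have "g a \<le> (\<Sum>x\<in>A. p x * g x)" if g: "\<forall>b\<in>A. g b \<le> (\<Sum>x\<in>A. k b x * g x)" for g
  proof -
    have step: "g a \<le> (\<Sum>x\<in>A. ?P t x * g x)" for t
    proof (induction t)
      case 0
      then show ?case using sum_point_mass[OF fin a, of g] by simp
    next
      case (Suc t)
      also have "(\<Sum>x\<in>A. ?P t x * g x) \<le> (\<Sum>b\<in>A. ?P t b * (\<Sum>x\<in>A. k b x * g x))"
        using g distP[of t] by (intro sum_mono mult_left_mono) (auto simp: distribution_def)
      finally show ?case by (simp add: sum_push)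
    qed
    have "real (Suc n) * g a \<le> (\<Sum>t<Suc n. \<Sum>x\<in>A. ?P t x * g x)" for n
      using sum_mono[of "{..<Suc n}" "\<lambda>_. g a", OF step] by simp
    then have "g a \<le> (\<Sum>x\<in>A. Q n x * g x)" for n
      unfolding avg by (simp add: field_simps)
    then show ?thesis using lim_avg[of g] by (meson LIMSEQ_le_const)
  qed
  ultimately show ?thesis by blast
qed

section \<open>Strictly complementary dual weights\<close>

context finite_strategies
begin

text \<open>
The total gain of all players at \<open>c\<close> when each player \<open>i\<close> replaces the recommendation \<open>c i\<close> by \<open>d\<close> with
weight \<open>\<alpha> i (c i) d\<close>. This is the column of \<open>c\<close> in the incentive constraints, combined with the
multipliers \<open>\<alpha>\<close>; adding diagonal weight \<open>\<alpha> i a a\<close> does not change it.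
\<close>

definition dual_gain ::
    "('i \<Rightarrow> ('i \<Rightarrow> 's) \<Rightarrow> real) \<Rightarrow> ('i \<Rightarrow> 's \<Rightarrow> 's \<Rightarrow> real) \<Rightarrow> ('i \<Rightarrow> 's) \<Rightarrow> real" where
  "dual_gain U \<alpha> c = (\<Sum>i\<in>N. \<Sum>d\<in>C i. \<alpha> i (c i) d * (U i (c(i := d)) - U i c))"

definition excluded :: "('i \<Rightarrow> ('i \<Rightarrow> 's) \<Rightarrow> real) \<Rightarrow> ('i \<Rightarrow> 's) \<Rightarrow> bool" where
  "excluded U c \<longleftrightarrow> (\<forall>\<mu>. correlated_equilibrium N C U \<mu> \<longrightarrow> pmf \<mu> c = 0)"

lemma embed_distribution:
  assumes "finite A" "distribution A p"
  shows "\<exists>q. \<forall>x. pmf q x = (if x \<in> A then p x else 0)"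
proof -
  let ?f = "\<lambda>x. if x \<in> A then p x else 0"
  have "(\<integral>\<^sup>+x. ennreal (?f x) \<partial>count_space UNIV) = (\<Sum>x\<in>A. ennreal (?f x))"
    using assms by (intro nn_integral_count_space') auto
  also have "\<dots> = ennreal (\<Sum>x\<in>A. ?f x)"
    using assms by (intro sum_ennreal) (auto simp: distribution_def)
  also have "\<dots> = 1" using assms by (simp add: distribution_def)
  finally show ?thesis
    using assms by (intro exI[of _ "embed_pmf ?f"] allI pmf_embed_pmf) (auto simp: distribution_def)
qed

lemma correlated_equilibrium_from_weights:
  assumes nonneg: "\<forall>c\<in>Pi\<^sub>E N C. 0 \<le> x c"
    and c0: "c0 \<in> Pi\<^sub>E N C" "0 < x c0"
    and incentive: "\<And>i a d. i \<in> N \<Longrightarrow> a \<in> C i \<Longrightarrow> d \<in> C i \<Longrightarrow>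
      (\<Sum>b\<in>Pi\<^sub>E (N - {i}) C. x (b(i := a)) * (U i (b(i := d)) - U i (b(i := a)))) \<le> 0"
  shows "\<not> excluded U c0"
proof -
  let ?Z = "sum x (Pi\<^sub>E N C)"
  have Z: "0 < ?Z" by (rule sum_pos2[OF finite_profiles c0(1), of x]) (use c0 nonneg in auto)
  have "distribution (Pi\<^sub>E N C) (\<lambda>c. x c / ?Z)"
    using nonneg Z by (auto simp: distribution_def sum_divide_distrib[symmetric])
  from embed_distribution[OF finite_profiles this]
  obtain \<mu> where \<mu>: "\<And>c. pmf \<mu> c = (if c \<in> Pi\<^sub>E N C then x c / ?Z else 0)" by blast
  have upd: "b(i := a) \<in> Pi\<^sub>E N C" if "i \<in> N" "a \<in> C i" "b \<in> Pi\<^sub>E (N - {i}) C" for b i a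
    using PiE_fun_upd[OF that(2,3)] that(1) by (simp add: insert_absorb)
  have "correlated_equilibrium N C U \<mu>"
    unfolding correlated_equilibrium_def profiles_def
  proof (intro conjI ballI)
    show "set_pmf \<mu> \<subseteq> Pi\<^sub>E N C" by (auto simp: set_pmf_eq \<mu> split: if_splits)
    fix i a d assume i: "i \<in> N" and a: "a \<in> C i" and d: "d \<in> C i"
    have "(\<Sum>b\<in>Pi\<^sub>E (N - {i}) C. pmf \<mu> (b(i := a)) * (U i (b(i := d)) - U i (b(i := a))))
        = (\<Sum>b\<in>Pi\<^sub>E (N - {i}) C. x (b(i := a)) * (U i (b(i := d)) - U i (b(i := a)))) / ?Z"
      unfolding sum_divide_distrib using upd[OF i a] by (intro sum.cong refl) (simp add: \<mu>)
    also have "\<dots> \<le> 0" using incentive[OF i a d] Z by (simp add: divide_nonpos_pos)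
    finally show "(\<Sum>b\<in>Pi\<^sub>E (N - {i}) C. pmf \<mu> (b(i := a)) * (U i (b(i := d)) - U i (b(i := a)))) \<le> 0" .
  qed
  moreover have "pmf \<mu> c0 \<noteq> 0" using c0 Z by (simp add: \<mu>)
  ultimately show ?thesis by (auto simp: excluded_def)
qed

text \<open>
By Farkas, since the incentive constraints and nonnegativity force \<open>x c0 \<le> 0\<close>: any solution with
\<open>x c0 > 0\<close> could be normalised to a correlated equilibrium that charges \<open>c0\<close>.
\<close>

lemma dual_weights_for_excluded_profile:
  assumes c0: "c0 \<in> Pi\<^sub>E N C" and ex: "excluded U c0"
  shows "\<exists>w. (\<forall>i\<in>N. \<forall>a\<in>C i. \<forall>d\<in>C i. 0 \<le> w i a d) \<and>
    (\<forall>c\<in>Pi\<^sub>E N C. (if c = c0 then 1 else 0) \<le> dual_gain U w c)"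
proof -
  define K where "K = (SIGMA i:N. C i \<times> C i)"
  define M where "M k c = (case k of (i, a, d) \<Rightarrow> if c i = a then U i (c(i := d)) - U i c else 0)" for k c
  have finK: "finite K" unfolding K_def using finite_players finite_C by auto
  have one: "(\<Sum>c\<in>Pi\<^sub>E N C. (if c = c0 then 1 else 0) * x c) = x c0" for x :: "_ \<Rightarrow> real"
    using sum_point_mass[OF finite_profiles c0, of x] by (simp add: point_mass_def)
  have "\<exists>u. (\<forall>k\<in>K. 0 \<le> u k) \<and> (\<forall>c\<in>Pi\<^sub>E N C. (if c = c0 then 1 else 0) \<le> (\<Sum>k\<in>K. u k * M k c))"
  proof (rule farkas_nonneg[OF finK finite_profiles])
    fix x :: "('i \<Rightarrow> 's) \<Rightarrow> real"
    assume x: "\<forall>c\<in>Pi\<^sub>E N C. 0 \<le> x c" and Mx: "\<forall>k\<in>K. (\<Sum>c\<in>Pi\<^sub>E N C. M k c * x c) \<le> 0"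
    have incentive: "(\<Sum>b\<in>Pi\<^sub>E (N - {i}) C. x (b(i := a)) * (U i (b(i := d)) - U i (b(i := a)))) \<le> 0"
      if "i \<in> N" "a \<in> C i" "d \<in> C i" for i a d
    proof -
      have "(\<Sum>c\<in>Pi\<^sub>E N C. M (i, a, d) c * x c)
          = (\<Sum>b\<in>Pi\<^sub>E (N - {i}) C. \<Sum>a'\<in>C i. point_mass a a' * ((U i (b(i := d)) - U i (b(i := a'))) * x (b(i := a'))))"
        unfolding sum_PiE_split[OF that(1)] by (intro sum.cong refl) (simp add: M_def point_mass_def)
      then show ?thesis
        using Mx[rule_format, of "(i, a, d)"] that sum_point_mass[OF finite_C[OF that(1)] that(2)]
        by (simp add: K_def mult.commute)
    qed
    have "\<not> 0 < x c0"
      using correlated_equilibrium_from_weights[OF x c0 _ incentive] ex by blast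
    then show "(\<Sum>c\<in>Pi\<^sub>E N C. (if c = c0 then 1 else 0) * x c) \<le> 0"
      unfolding one by simp
  qed
  then obtain u where u: "\<forall>k\<in>K. 0 \<le> u k"
    "\<forall>c\<in>Pi\<^sub>E N C. (if c = c0 then 1 else 0) \<le> (\<Sum>k\<in>K. u k * M k c)" by blast
  have "(\<Sum>k\<in>K. u k * M k c) = dual_gain U (\<lambda>i a d. u (i, a, d)) c" if c: "c \<in> Pi\<^sub>E N C" for c
  proof -
    have "(\<Sum>k\<in>K. u k * M k c)
        = (\<Sum>i\<in>N. \<Sum>(a, d)\<in>C i \<times> C i. u (i, a, d) * M (i, a, d) c)"
      unfolding K_def using finite_players finite_C by (subst sum.Sigma) (auto simp: case_prod_beta')
    also have "\<dots> = (\<Sum>i\<in>N. \<Sum>a\<in>C i. point_mass (c i) a *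
        (\<Sum>d\<in>C i. u (i, a, d) * (U i (c(i := d)) - U i c)))"
      unfolding sum.cartesian_product[symmetric]
      by (intro sum.cong refl) (auto simp: M_def point_mass_def)
    also have "\<dots> = dual_gain U (\<lambda>i a d. u (i, a, d)) c"
      unfolding dual_gain_def using c finite_C
      by (intro sum.cong refl sum_point_mass) (auto dest: PiE_mem)
    finally show ?thesis .
  qed
  then show ?thesis using u by (intro exI[of _ "\<lambda>i a d. u (i, a, d)"]) (auto simp: K_def)
qed

text \<open>
The dual weights of the individual excluded profiles add up to weights that are strict at all of
them at once. Divided by a bound \<open>B\<close> on the row sums they are substochastic, and the missing mass
goes to the diagonal, where no gain is at stake.
\<close>

lemma strict_dual_kernel_exists:
  "\<exists>\<alpha>. (\<forall>i\<in>N. \<forall>a\<in>C i. distribution (C i) (\<alpha> i a)) \<and>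
    (\<forall>c\<in>Pi\<^sub>E N C. 0 \<le> dual_gain U \<alpha> c \<and> (excluded U c \<longrightarrow> 0 < dual_gain U \<alpha> c))"
proof -
  define Z where "Z = {c \<in> Pi\<^sub>E N C. excluded U c}"
  have finZ: "finite Z" using finite_profiles by (simp add: Z_def)
  have "\<exists>w. \<forall>z\<in>Z. (\<forall>i\<in>N. \<forall>a\<in>C i. \<forall>d\<in>C i. 0 \<le> w z i a d) \<and>
    (\<forall>c\<in>Pi\<^sub>E N C. (if c = z then 1 else 0) \<le> dual_gain U (w z) c)"
    by (rule bchoice) (simp add: Z_def dual_weights_for_excluded_profile)
  then obtain w where w_all: "\<forall>z\<in>Z. (\<forall>i\<in>N. \<forall>a\<in>C i. \<forall>d\<in>C i. 0 \<le> w z i a d) \<and>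
    (\<forall>c\<in>Pi\<^sub>E N C. (if c = z then 1 else 0) \<le> dual_gain U (w z) c)" ..
  have w: "0 \<le> w z i a d" if "z \<in> Z" "i \<in> N" "a \<in> C i" "d \<in> C i" for z i a d
    using w_all that by simp
  have gain_w: "(if c = z then 1 else 0) \<le> dual_gain U (w z) c" if "z \<in> Z" "c \<in> Pi\<^sub>E N C" for z c
    by (rule w_all[rule_format, OF that(1), THEN conjunct2, rule_format, OF that(2)])
  define W where "W i a d = (\<Sum>z\<in>Z. w z i a d)" for i a d
  have W_nonneg: "0 \<le> W i a d" if "i \<in> N" "a \<in> C i" "d \<in> C i" for i a d
    unfolding W_def using w that by (intro sum_nonneg) auto
  have gain_W: "dual_gain U W c = (\<Sum>z\<in>Z. dual_gain U (w z) c)" for c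
  proof -
    have "dual_gain U W c = (\<Sum>i\<in>N. \<Sum>z\<in>Z. \<Sum>d\<in>C i. w z i (c i) d * (U i (c(i := d)) - U i c))"
      unfolding dual_gain_def W_def sum_distrib_right by (rule sum.cong[OF refl], rule sum.swap)
    also have "\<dots> = (\<Sum>z\<in>Z. dual_gain U (w z) c)" unfolding dual_gain_def by (rule sum.swap)
    finally show ?thesis .
  qed
  have ind_nonneg: "0 \<le> dual_gain U (w z) c" if "z \<in> Z" "c \<in> Pi\<^sub>E N C" for z c
    using gain_w[OF that] by (auto split: if_splits)
  have nonneg: "0 \<le> dual_gain U W c" if "c \<in> Pi\<^sub>E N C" for c
    unfolding gain_W using ind_nonneg that by (intro sum_nonneg) auto
  have pos: "0 < dual_gain U W c" if c: "c \<in> Pi\<^sub>E N C" "excluded U c" for c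
  proof -
    have cZ: "c \<in> Z" using c by (simp add: Z_def)
    have "0 < dual_gain U (w c) c" using gain_w[OF cZ c(1)] by simp
    then show ?thesis unfolding gain_W using ind_nonneg c by (intro sum_pos2[OF finZ cZ]) auto
  qed
  define B where "B = 1 + (\<Sum>i\<in>N. \<Sum>a\<in>C i. \<Sum>d\<in>C i. W i a d)"
  have row: "(\<Sum>d\<in>C i. W i a d) \<le> B" if "i \<in> N" "a \<in> C i" for i a
  proof -
    have "(\<Sum>d\<in>C i. W i a d) \<le> (\<Sum>a\<in>C i. \<Sum>d\<in>C i. W i a d)"
      using that W_nonneg finite_C by (intro member_le_sum[of a "C i"] sum_nonneg) auto
    also have "\<dots> \<le> (\<Sum>i\<in>N. \<Sum>a\<in>C i. \<Sum>d\<in>C i. W i a d)"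
      using that W_nonneg finite_players
      by (intro member_le_sum[of i N "\<lambda>i. \<Sum>a\<in>C i. \<Sum>d\<in>C i. W i a d"] sum_nonneg) auto
    finally show ?thesis by (simp add: B_def)
  qed
  have B: "0 < B"
    unfolding B_def using W_nonneg by (intro add_pos_nonneg sum_nonneg) auto
  define \<alpha> where "\<alpha> i a d = W i a d / B + (1 - (\<Sum>d\<in>C i. W i a d) / B) * point_mass a d" for i a d
  have "distribution (C i) (\<alpha> i a)" if i: "i \<in> N" and a: "a \<in> C i" for i a
  proof -
    have "sum (\<alpha> i a) (C i) = 1"
    proof -
      have "sum (\<alpha> i a) (C i) = (\<Sum>d\<in>C i. W i a d) / B
          + (1 - (\<Sum>d\<in>C i. W i a d) / B) * (\<Sum>d\<in>C i. point_mass a d)"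
        unfolding \<alpha>_def sum.distrib sum_divide_distrib sum_distrib_left ..
      then show ?thesis using sum_point_mass[OF finite_C[OF i] a, of "\<lambda>_. 1"] by simp
    qed
    moreover have "0 \<le> \<alpha> i a d" if "d \<in> C i" for d
      unfolding \<alpha>_def point_mass_def using row[OF i a] B W_nonneg[OF i a that]
      by (intro add_nonneg_nonneg mult_nonneg_nonneg) auto
    ultimately show ?thesis by (simp add: distribution_def)
  qed
  moreover have "dual_gain U \<alpha> c = dual_gain U W c / B" if c: "c \<in> Pi\<^sub>E N C" for c
  proof -
    have "(\<Sum>d\<in>C i. \<alpha> i (c i) d * (U i (c(i := d)) - U i c))
        = (\<Sum>d\<in>C i. W i (c i) d * (U i (c(i := d)) - U i c)) / B" for i
      unfolding sum_divide_distrib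
      by (intro sum.cong refl) (auto simp: \<alpha>_def point_mass_def)
    then show ?thesis by (simp add: dual_gain_def sum_divide_distrib)
  qed
  ultimately show ?thesis
    using nonneg pos B by (intro exI[of _ \<alpha>]) (simp add: divide_nonneg_pos)
qed

section \<open>Equilibria invariant under the dual kernel\<close>

lemma expected_dual_gain:
  assumes stoch: "\<And>i a. i \<in> N \<Longrightarrow> a \<in> C i \<Longrightarrow> distribution (C i) (\<alpha> i a)"
  shows "EU (dual_gain U \<alpha>) \<sigma>
    = (\<Sum>j\<in>N. EU (U j) (\<sigma>(j := push (C j) (\<sigma> j) (\<alpha> j))) - EU (U j) \<sigma>)"
proof -
  have "dual_gain U \<alpha> c = (\<Sum>j\<in>N. (\<Sum>d\<in>C j. \<alpha> j (c j) d * U j (c(j := d))) - U j c)"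
    if "c \<in> Pi\<^sub>E N C" for c
    unfolding dual_gain_def
  proof (intro sum.cong refl)
    fix j assume j: "j \<in> N"
    have "sum (\<alpha> j (c j)) (C j) = 1" using stoch[OF j, of "c j"] that j by (auto simp: distribution_def dest: PiE_mem)
    then show "(\<Sum>d\<in>C j. \<alpha> j (c j) d * (U j (c(j := d)) - U j c))
        = (\<Sum>d\<in>C j. \<alpha> j (c j) d * U j (c(j := d))) - U j c"
      by (simp add: right_diff_distrib sum_subtractf sum_distrib_right[symmetric])
  qed
  then have "EU (dual_gain U \<alpha>) \<sigma>
      = EU (\<lambda>c. \<Sum>j\<in>N. (\<Sum>d\<in>C j. \<alpha> j (c j) d * U j (c(j := d))) - U j c) \<sigma>"
    unfolding expected_def by (intro sum.cong) auto
  also have "\<dots> = (\<Sum>j\<in>N. EU (U j) (\<sigma>(j := push (C j) (\<sigma> j) (\<alpha> j))) - EU (U j) \<sigma>)"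
    unfolding expected_sum[of _ N] expected_diff by (intro sum.cong refl) (simp only: expected_deviation)
  finally show ?thesis .
qed

text \<open>
If the opponents' strategies are invariant, their kernels change nothing, and the whole expected
gain is that of player \<open>i\<close> replacing \<open>a\<close> by a draw from \<open>\<alpha> i a\<close>. So the sign of \<open>dual_gain\<close> says
whether one step of the kernel improves on the pure strategy \<open>a\<close>.
\<close>

lemma expected_dual_gain_pure:
  assumes stoch: "\<And>i a. i \<in> N \<Longrightarrow> a \<in> C i \<Longrightarrow> distribution (C i) (\<alpha> i a)"
    and inv: "\<And>j x. j \<in> N \<Longrightarrow> x \<in> C j \<Longrightarrow> push (C j) (\<sigma> j) (\<alpha> j) x = \<sigma> j x"
    and i: "i \<in> N" and a: "a \<in> C i"
  shows "EU (dual_gain U \<alpha>) (\<sigma>(i := point_mass a))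
    = (\<Sum>d\<in>C i. \<alpha> i a d * EU (U i) (\<sigma>(i := point_mass d))) - EU (U i) (\<sigma>(i := point_mass a))"
proof -
  let ?\<tau> = "\<sigma>(i := point_mass a)"
  let ?change = "\<lambda>j. EU (U j) (?\<tau>(j := push (C j) (?\<tau> j) (\<alpha> j))) - EU (U j) ?\<tau>"
  have "?change j = 0" if "j \<in> N - {i}" for j
    using that inv by (simp, intro expected_cong) auto
  then have "(\<Sum>j\<in>N - {i}. ?change j) = 0" by (intro sum.neutral) blast
  moreover have "EU (dual_gain U \<alpha>) ?\<tau> = (\<Sum>j\<in>N. ?change j)"
    using stoch by (rule expected_dual_gain)
  ultimately have "EU (dual_gain U \<alpha>) ?\<tau> = ?change i"
    by (simp only: sum.remove[OF finite_players i] add_0_right)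
  also have "EU (U i) (?\<tau>(i := push (C i) (?\<tau> i) (\<alpha> i))) = EU (U i) (\<sigma>(i := \<alpha> i a))"
    using sum_point_mass[OF finite_C[OF i] a] by (intro expected_cong) (auto simp: push_def)
  also have "\<dots> = (\<Sum>d\<in>C i. \<alpha> i a d * EU (U i) (\<sigma>(i := point_mass d)))"
    by (rule expected_pure[OF i])
  finally show ?thesis .
qed

text \<open>
Let each pure strategy \<open>a\<close> stand for an invariant mixed strategy \<open>E i a\<close> reached from it, and take
an equilibrium of the resulting game. In the original game it is invariant and no player gains by
a deviation to some \<open>E i a\<close>. The other deviations do no better: against invariant opponents each
step of the dual kernel weakly improves on \<open>a\<close>, so \<open>E i a\<close> is at least as good as \<open>a\<close>.
\<close>

theorem invariant_equilibrium_exists: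
  assumes stoch: "\<And>i a. i \<in> N \<Longrightarrow> a \<in> C i \<Longrightarrow> distribution (C i) (\<alpha> i a)"
    and dual: "\<And>c. c \<in> Pi\<^sub>E N C \<Longrightarrow> 0 \<le> dual_gain U \<alpha> c"
  shows "\<exists>\<sigma>. (\<forall>j\<in>N. distribution (C j) (\<sigma> j)) \<and>
    (\<forall>j\<in>N. \<forall>x\<in>C j. push (C j) (\<sigma> j) (\<alpha> j) x = \<sigma> j x) \<and>
    (\<forall>i\<in>N. \<forall>a\<in>C i. EU (U i) (\<sigma>(i := point_mass a)) \<le> EU (U i) \<sigma>)"
proof -
  define reaches where "reaches i a p \<longleftrightarrow>
    distribution (C i) p \<and> (\<forall>x\<in>C i. push (C i) p (\<alpha> i) x = p x) \<and>
    (\<forall>g. (\<forall>b\<in>C i. g b \<le> (\<Sum>x\<in>C i. \<alpha> i b x * g x)) \<longrightarrow> g a \<le> (\<Sum>x\<in>C i. p x * g x))" for i a p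
  define E where "E i a = (SOME p. reaches i a p)" for i a
  have reaches_E: "reaches i a (E i a)" if "i \<in> N" "a \<in> C i" for i a
  proof -
    have "\<exists>p. reaches i a p"
      unfolding reaches_def using that by (intro invariant_kernel_exists finite_C stoch)
    then show ?thesis unfolding E_def by (rule someI_ex)
  qed
  have E_dist: "distribution (C i) (E i a)" if "i \<in> N" "a \<in> C i" for i a
    using reaches_E[OF that] by (simp only: reaches_def)
  have E_inv: "push (C i) (E i a) (\<alpha> i) x = E i a x" if "i \<in> N" "a \<in> C i" "x \<in> C i" for i a x
    using reaches_E[OF that(1,2)] that(3) by (simp only: reaches_def)
  have E_sup: "g a \<le> (\<Sum>x\<in>C i. E i a x * g x)"
    if "i \<in> N" "a \<in> C i" "\<forall>b\<in>C i. g b \<le> (\<Sum>x\<in>C i. \<alpha> i b x * g x)" for i a g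
    using reaches_E[OF that(1,2)] that(3) unfolding reaches_def by blast
  define V where "V i c = EU (U i) (\<lambda>j. E j (c j))" for i c
  obtain \<rho> where \<rho>_dist: "\<forall>i\<in>N. distribution (C i) (\<rho> i)"
    and \<rho>_nash: "\<forall>i\<in>N. \<forall>a\<in>C i. EU (V i) (\<rho>(i := point_mass a)) \<le> EU (V i) \<rho>"
    using nash_exists[of V] by blast
  define \<sigma> where "\<sigma> j = push (C j) (\<rho> j) (E j)" for j
  have \<sigma>_dist: "distribution (C j) (\<sigma> j)" if "j \<in> N" for j
    unfolding \<sigma>_def using that \<rho>_dist E_dist by (intro distribution_push) auto
  have \<sigma>_inv: "push (C j) (\<sigma> j) (\<alpha> j) x = \<sigma> j x" if "j \<in> N" "x \<in> C j" for j x
  proof -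
    have "push (C j) (\<sigma> j) (\<alpha> j) x = (\<Sum>b\<in>C j. \<rho> j b * push (C j) (E j b) (\<alpha> j) x)"
      unfolding \<sigma>_def push_def[of _ "push _ _ _"] sum_push by (simp add: push_def)
    then show ?thesis using E_inv that by (simp add: \<sigma>_def push_def)
  qed
  have "EU (U i) (\<sigma>(i := point_mass a)) \<le> EU (U i) \<sigma>" if i: "i \<in> N" and a: "a \<in> C i" for i a
  proof -
    let ?g = "\<lambda>d. EU (U i) (\<sigma>(i := point_mass d))"
    have "?g b \<le> (\<Sum>d\<in>C i. \<alpha> i b d * ?g d)" if b: "b \<in> C i" for b
    proof -
      have "0 \<le> EU (dual_gain U \<alpha>) (\<sigma>(i := point_mass b))"
        using \<sigma>_dist distribution_point_mass[OF finite_C[OF i] b] dual by (intro expected_nonneg) auto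
      then show ?thesis using expected_dual_gain_pure[OF stoch \<sigma>_inv i b] by simp
    qed
    then have "?g a \<le> (\<Sum>x\<in>C i. E i a x * ?g x)" using E_sup[OF i a, of ?g] by simp
    also have "\<dots> = EU (U i) (\<sigma>(i := E i a))" by (rule expected_pure[OF i, symmetric])
    also have "\<dots> = EU (V i) (\<rho>(i := point_mass a))"
      unfolding V_def expected_substitute \<sigma>_def
      using sum_point_mass[OF finite_C[OF i] a] by (intro expected_cong) (auto simp: push_def)
    also have "\<dots> \<le> EU (V i) \<rho>" using \<rho>_nash i a by blast
    also have "\<dots> = EU (U i) \<sigma>" unfolding V_def expected_substitute \<sigma>_def ..
    finally show ?thesis .
  qed
  then show ?thesis using \<sigma>_dist \<sigma>_inv by blast
qed

end

section \<open>Equilibria without null strategies as best responses\<close>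

theorem proposition2:
  fixes N :: "'i set"
    and C :: "'i \<Rightarrow> 's set"
    and U :: "'i \<Rightarrow> ('i \<Rightarrow> 's) \<Rightarrow> real"
  assumes "finite_game N C U"
  shows "\<exists>\<sigma>. nash_equilibrium N C U \<sigma> \<and>
           (\<forall>i\<in>N. \<forall>a\<in>C i.
              (\<forall>\<mu>. correlated_equilibrium N C U \<mu> \<longrightarrow> marginal_prob N C \<mu> i a = 0) \<longrightarrow>
              \<not> best_response N C U i (return_pmf a) \<sigma>)"
proof -
  interpret finite_strategies N C
    using assms by unfold_locales (auto simp: finite_game_def)
  obtain \<alpha> where stoch: "\<And>i a. i \<in> N \<Longrightarrow> a \<in> C i \<Longrightarrow> distribution (C i) (\<alpha> i a)"
    and dual: "\<And>c. c \<in> Pi\<^sub>E N C \<Longrightarrow> 0 \<le> dual_gain U \<alpha> c"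
    and strict: "\<And>c. c \<in> Pi\<^sub>E N C \<Longrightarrow> excluded U c \<Longrightarrow> 0 < dual_gain U \<alpha> c"
    using strict_dual_kernel_exists[of U] by blast
  obtain \<sigma> where dist: "\<And>j. j \<in> N \<Longrightarrow> distribution (C j) (\<sigma> j)"
    and inv: "\<And>j x. j \<in> N \<Longrightarrow> x \<in> C j \<Longrightarrow> push (C j) (\<sigma> j) (\<alpha> j) x = \<sigma> j x"
    and nash: "\<And>i a. i \<in> N \<Longrightarrow> a \<in> C i \<Longrightarrow> EU (U i) (\<sigma>(i := point_mass a)) \<le> EU (U i) \<sigma>"
    using invariant_equilibrium_exists[of \<alpha> U, OF stoch dual] by blast
  have "\<exists>q. \<forall>x. j \<in> N \<longrightarrow> pmf q x = (if x \<in> C j then \<sigma> j x else 0)" for j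
    using embed_distribution[OF finite_C dist, of j] by (cases "j \<in> N") auto
  then obtain s where s: "\<And>j x. j \<in> N \<Longrightarrow> pmf (s j) x = (if x \<in> C j then \<sigma> j x else 0)" by metis
  have util: "mixed_utility N C U i (s(i := \<rho>)) = (\<Sum>a\<in>C i. pmf \<rho> a * EU (U i) (\<sigma>(i := point_mass a)))"
    if i: "i \<in> N" for i \<rho>
  proof -
    have "mixed_utility N C U i (s(i := \<rho>)) = EU (U i) (\<lambda>j. pmf ((s(i := \<rho>)) j))"
      by (simp add: mixed_utility_def expected_def profiles_def)
    also have "\<dots> = EU (U i) (\<sigma>(i := pmf \<rho>))" using s by (intro expected_cong) auto
    also have "\<dots> = (\<Sum>a\<in>C i. pmf \<rho> a * EU (U i) (\<sigma>(i := point_mass a)))"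
      by (rule expected_pure[OF i])
    finally show ?thesis .
  qed
  have util_s: "mixed_utility N C U i (s(i := s i)) = EU (U i) \<sigma>" if i: "i \<in> N" for i
  proof -
    have "mixed_utility N C U i (s(i := s i)) = (\<Sum>a\<in>C i. \<sigma> i a * EU (U i) (\<sigma>(i := point_mass a)))"
      unfolding util[OF i] using s[OF i] by (intro sum.cong) auto
    also have "\<dots> = EU (U i) (\<sigma>(i := \<sigma> i))" by (rule expected_pure[OF i, symmetric])
    finally show ?thesis by (simp only: fun_upd_triv)
  qed
  have s_mixed: "s i \<in> mixed_strategies C i" if "i \<in> N" for i
    using s[OF that] by (auto simp: mixed_strategies_def set_pmf_eq split: if_splits)
  have "nash_equilibrium N C U s"
    unfolding nash_equilibrium_def best_response_def
  proof (intro ballI conjI)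
    fix i assume i: "i \<in> N"
    show "s i \<in> mixed_strategies C i" using s_mixed[OF i] .
    fix \<rho> assume "\<rho> \<in> mixed_strategies C i"
    then have one: "(\<Sum>a\<in>C i. pmf \<rho> a) = 1"
      using finite_C[OF i] by (intro sum_pmf_eq_1) (auto simp: mixed_strategies_def)
    have "mixed_utility N C U i (s(i := \<rho>)) \<le> (\<Sum>a\<in>C i. pmf \<rho> a * EU (U i) \<sigma>)"
      unfolding util[OF i] using nash[OF i] by (intro sum_mono mult_left_mono) auto
    also have "\<dots> = EU (U i) \<sigma>" using one by (simp add: sum_distrib_right[symmetric])
    finally show "mixed_utility N C U i (s(i := \<rho>)) \<le> mixed_utility N C U i (s(i := s i))"
      unfolding util_s[OF i] .
  qed
  moreover have "\<not> best_response N C U i (return_pmf a) s"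
    if i: "i \<in> N" and a: "a \<in> C i"
      and zero: "\<And>\<mu>. correlated_equilibrium N C U \<mu> \<Longrightarrow> marginal_prob N C \<mu> i a = 0" for i a
  proof -
    let ?g = "\<lambda>d. EU (U i) (\<sigma>(i := point_mass d))"
    \<comment> \<open>A null marginal makes every profile that uses \<open>a\<close> null, so the dual gain is strict against \<open>a\<close>.\<close>
    have exc: "excluded U c" if c: "c \<in> Pi\<^sub>E N C" "c i = a" for c
      unfolding excluded_def
    proof (intro allI impI)
      fix \<mu> assume "correlated_equilibrium N C U \<mu>"
      then have m0: "(\<Sum>b\<in>Pi\<^sub>E (N - {i}) C. pmf \<mu> (b(i := a))) = 0"
        using zero by (simp add: marginal_prob_def profiles_def)
      have fin: "finite (Pi\<^sub>E (N - {i}) C)" using finite_players finite_C by (intro finite_PiE) auto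
      have "c(i := undefined) \<in> Pi\<^sub>E (N - {i}) C" using c by (auto simp: PiE_iff extensional_def)
      moreover have "\<forall>b\<in>Pi\<^sub>E (N - {i}) C. pmf \<mu> (b(i := a)) = 0"
        using m0 sum_nonneg_eq_0_iff[OF fin, of "\<lambda>b. pmf \<mu> (b(i := a))"] by simp
      ultimately have "pmf \<mu> ((c(i := undefined))(i := a)) = 0" by blast
      then show "pmf \<mu> c = 0" using c(2) by (simp add: fun_upd_idem)
    qed
    have "0 < EU (dual_gain U \<alpha>) (\<sigma>(i := point_mass a))"
    proof (rule expected_pos)
      show "distribution (C j) ((\<sigma>(i := point_mass a)) j)" if "j \<in> N" for j
        using that dist distribution_point_mass[OF finite_C[OF i] a] by auto
      show "0 \<le> dual_gain U \<alpha> c" if "c \<in> Pi\<^sub>E N C" for c using dual that .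
      fix c assume c: "c \<in> Pi\<^sub>E N C" and "\<And>j. j \<in> N \<Longrightarrow> 0 < (\<sigma>(i := point_mass a)) j (c j)"
      from this(2)[OF i] have "c i = a" by (auto simp: point_mass_def split: if_splits)
      then show "0 < dual_gain U \<alpha> c" using strict exc c by blast
    qed
    then have "?g a < (\<Sum>d\<in>C i. \<alpha> i a d * ?g d)"
      using expected_dual_gain_pure[OF stoch inv i a] by simp
    \<comment> \<open>No pure strategy in this average exceeds the equilibrium payoff.\<close>
    also have "\<dots> \<le> (\<Sum>d\<in>C i. \<alpha> i a d * EU (U i) \<sigma>)"
      using stoch[OF i a] nash[OF i] by (intro sum_mono mult_left_mono) (auto simp: distribution_def)
    also have "\<dots> = EU (U i) \<sigma>"
      using stoch[OF i a] by (simp add: distribution_def sum_distrib_right[symmetric])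
    finally have less: "?g a < EU (U i) \<sigma>" .
    have "pmf (return_pmf a) = point_mass a" by (auto simp: point_mass_def indicator_def)
    then have "mixed_utility N C U i (s(i := return_pmf a)) = ?g a"
      unfolding util[OF i] using sum_point_mass[OF finite_C[OF i] a, of ?g] by simp
    then have "mixed_utility N C U i (s(i := return_pmf a)) < mixed_utility N C U i (s(i := s i))"
      using less unfolding util_s[OF i] by (simp only:)
    then show ?thesis
      using s_mixed[OF i] unfolding best_response_def by (auto simp only: not_le dest!: bspec)
  qed
  ultimately show ?thesis by blast
qed

end
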